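(* For every real $x \in (0,1)$, $$\frac{1}{3}\, x\, R_D(1,1,x^2) = \frac{1}{2}\, \frac{\mathrm{d}^2}{\mathrm{d}x^2} \left[\arccos(x)\right]^2 .$$
   Context: $R_D$ denotes Carlson's symmetric elliptic integral, for arguments $x,y,z \in \mathbb{C}\setminus(-\infty,0]$ (here used with positive real arguments): $$R_D(x,y,z) := \frac{3}{2}\int_0^\infty \frac{1}{\sqrt{x+t}\,\sqrt{y+t}\,\sqrt{z+t}\,(z+t)}\,\mathrm{d}t .$$ Here $[\arccos(x)]^2$ is the square of the real principal arccosine. *)

theory Defs
  imports "HOL-Analysis.Analysis"
begin

text \<open>
  Carlson's symmetric elliptic integral of the second kind, meaningful for
  \<open>x, y, z\<close> in the plane cut along the nonpositive reals; all square roots are principal.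
\<close>

definition Carlson_RD :: "complex \<Rightarrow> complex \<Rightarrow> complex \<Rightarrow> complex" where
  "Carlson_RD x y z =
     3 / 2 * (LBINT t=0..\<infinity>.
       1 / (csqrt (x + of_real t) * csqrt (y + of_real t) * csqrt (z + of_real t) * (z + of_real t)))"

end

theory Submission
  imports Defs "HOL-Real_Asymp.Real_Asymp"
begin

text \<open>
  For \<open>0 < x < 1\<close> the integral is elementary: with \<open>s = sqrt (x\<^sup>2 + t)\<close> and
  \<open>c = sqrt (1 - x\<^sup>2)\<close> the integrand becomes \<open>2 / (s\<^sup>2 (c\<^sup>2 + s\<^sup>2))\<close>, which partial fractions
  integrate to \<open>2 / c\<^sup>2 * (1 / x - arccos x / c)\<close>. Differentiating \<open>arccos\<^sup>2\<close> twice gives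
  the same combination of \<open>x\<close>, \<open>c\<close> and \<open>arccos x\<close>.
\<close>

lemma second_deriv_arccos_squared:
  fixes x :: real
  assumes "-1 < x" "x < 1"
  shows "(deriv ^^ 2) (\<lambda>u. (arccos u)\<^sup>2) x
    = 2 / (1 - x\<^sup>2) - 2 * x * arccos x / (1 - x\<^sup>2) / sqrt (1 - x\<^sup>2)"
proof -
  have c2: "1 - u\<^sup>2 > 0" if "u \<in> {-1<..<1}" for u :: real
    using that by (simp add: abs_square_less_1 abs_less_iff)
  have first: "deriv (\<lambda>u. (arccos u)\<^sup>2) u = - 2 * arccos u / sqrt (1 - u\<^sup>2)"
    if "u \<in> {-1<..<1}" for u :: real
  proof (rule DERIV_imp_deriv)
    show "((\<lambda>u. (arccos u)\<^sup>2) has_field_derivative - 2 * arccos u / sqrt (1 - u\<^sup>2)) (at u)"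
      using that c2[OF that] by (auto intro!: derivative_eq_intros simp: divide_simps)
  qed
  have x: "x \<in> {-1<..<1}" using assms by simp
  \<comment> \<open>The outer \<open>deriv\<close> sees its argument only near \<open>x\<close>, so
    agreement with the closed form on a neighbourhood of \<open>x\<close> is enough to differentiate
    that form instead.\<close>
  have "eventually (\<lambda>u. u \<in> {-1<..<1}) (nhds x)"
    using x by (intro eventually_nhds_in_open) auto
  then have ev: "eventually (\<lambda>u. deriv (\<lambda>u. (arccos u)\<^sup>2) u = - 2 * arccos u / sqrt (1 - u\<^sup>2)) (nhds x)"
    by (rule eventually_mono) (rule first)
  define c where "c = sqrt (1 - x\<^sup>2)"
  have c: "c > 0" "c\<^sup>2 = 1 - x\<^sup>2" using c2[OF x] by (auto simp: c_def)
  \<comment> \<open>The value is kept in quotient-rule shape: \<open>inverse (- c)\<close> is the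
    derivative of \<open>arccos\<close>, and \<open>(- 2 * x) * (inverse c / 2)\<close> that of the
    denominator.\<close>
  have "((\<lambda>u. - 2 * arccos u / sqrt (1 - u\<^sup>2)) has_real_derivative
      ((- 2 * inverse (- c)) * c - (- 2 * arccos x) * ((- 2 * x) * (inverse c / 2))) / (c * c)) (at x)"
    using assms c c2[OF x] unfolding c_def
    by (auto intro!: derivative_eq_intros simp: diff_divide_distrib mult_ac)
  also have "((- 2 * inverse (- c)) * c - (- 2 * arccos x) * ((- 2 * x) * (inverse c / 2))) / (c * c)
      = 2 / c\<^sup>2 - 2 * x * arccos x / c\<^sup>2 / c"
    using c(1) by (simp add: field_simps power2_eq_square)
  finally show ?thesis
    using deriv_cong_ev[OF ev refl] DERIV_imp_deriv c
    by (simp add: numeral_2_eq_2 c_def)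
qed

text \<open>Writing the first factor as \<open>c\<^sup>2 + r\<^sup>2 + t\<close> makes it
  \<open>c\<^sup>2 + s\<^sup>2\<close> for \<open>s = sqrt (r\<^sup>2 + t)\<close>, ready for
  partial fractions. When \<open>c\<^sup>2 + r\<^sup>2 = 1\<close>, the bracketed angle is
  \<open>arccos r\<close>.\<close>

lemma LBINT_inverse_three_halves:
  fixes r c :: real
  assumes r: "r > 0" and c: "c > 0"
  shows "(LBINT t=0..\<infinity>. 1 / ((c\<^sup>2 + r\<^sup>2 + t) * (sqrt (r\<^sup>2 + t) * (r\<^sup>2 + t))))
    = 2 / c\<^sup>2 * (1 / r - (pi / 2 - arctan (r / c)) / c)"
proof -
  \<comment> \<open>An antiderivative in \<open>s\<close>, from 1/(s^2 (c^2 + s^2)) = (1/s^2 -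
    1/(c^2 + s^2)) / c^2, already composed with \<open>s = sqrt (r\<^sup>2 + t)\<close>; no change
    of variables in the integral is needed.\<close>
  define F where "F = (\<lambda>t. 2 / c\<^sup>2 * (- 1 / sqrt (r\<^sup>2 + t) - arctan (sqrt (r\<^sup>2 + t) / c) / c))"
  have deriv: "(F has_real_derivative 1 / ((c\<^sup>2 + r\<^sup>2 + t) * (sqrt (r\<^sup>2 + t) * (r\<^sup>2 + t)))) (at t)"
    if "t > 0" for t
  proof -
    define s where "s = sqrt (r\<^sup>2 + t)"
    have pos: "r\<^sup>2 + t > 0" using that by (simp add: add_nonneg_pos)
    then have s: "s > 0" "r\<^sup>2 + t = s\<^sup>2" by (auto simp: s_def)
    have cs: "c\<^sup>2 + s\<^sup>2 > 0" using c by (simp add: add_pos_nonneg)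
    have sqrt': "((\<lambda>t. sqrt (r\<^sup>2 + t)) has_real_derivative inverse s / 2) (at t)"
      unfolding s_def using pos by (auto intro!: derivative_eq_intros)
    \<comment> \<open>Differentiate in \<open>s\<close> first; the chain rule then contributes ds/dt
      = 1/(2s).\<close>
    have "((\<lambda>s. 2 / c\<^sup>2 * (- 1 / s - arctan (s / c) / c)) has_real_derivative
        2 / c\<^sup>2 * (1 / s\<^sup>2 - inverse (1 + (s / c)\<^sup>2) / c\<^sup>2)) (at s)"
      using s(1) c by (auto intro!: derivative_eq_intros simp: power2_eq_square)
    also have "inverse (1 + (s / c)\<^sup>2) = c\<^sup>2 / (c\<^sup>2 + s\<^sup>2)"
      using c cs by (simp add: field_simps)
    finally have "(F has_real_derivative
        2 / c\<^sup>2 * (1 / s\<^sup>2 - c\<^sup>2 / (c\<^sup>2 + s\<^sup>2) / c\<^sup>2) * (inverse s / 2)) (at t)"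
      unfolding F_def s_def by (rule DERIV_chain2[OF _ sqrt'[unfolded s_def]])
    also have "2 / c\<^sup>2 * (1 / s\<^sup>2 - c\<^sup>2 / (c\<^sup>2 + s\<^sup>2) / c\<^sup>2) * (inverse s / 2)
        = 1 / ((c\<^sup>2 + s\<^sup>2) * (s * s\<^sup>2))"
      using s(1) c cs by (simp add: divide_simps)
    finally show ?thesis
      by (simp only: s_def[symmetric] s(2)[symmetric] add.assoc)
  qed
  \<comment> \<open>The integrand is nonnegative, so finite limits of \<open>F\<close> at both ends
    give the improper integral with no separate integrability proof. The endpoint is written
    \<open>ereal 0\<close> to match \<open>ereal_tendsto_simps\<close>.\<close>
  have "(LBINT t=ereal 0..\<infinity>. 1 / ((c\<^sup>2 + r\<^sup>2 + t) * (sqrt (r\<^sup>2 + t) * (r\<^sup>2 + t))))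
      = 2 / c\<^sup>2 * (- (pi / 2) / c) - F 0"
  proof (rule interval_integral_FTC_nonneg(2)[where F = F])
    fix t :: real assume "ereal 0 < ereal t"
    then have t: "t > 0" by simp
    then show "(F has_real_derivative 1 / ((c\<^sup>2 + r\<^sup>2 + t) * (sqrt (r\<^sup>2 + t) * (r\<^sup>2 + t)))) (at t)"
      by (rule deriv)
    have "r\<^sup>2 + t > 0" "c\<^sup>2 + r\<^sup>2 + t > 0"
      using t by (auto intro!: add_nonneg_pos)
    then show "isCont (\<lambda>t. 1 / ((c\<^sup>2 + r\<^sup>2 + t) * (sqrt (r\<^sup>2 + t) * (r\<^sup>2 + t)))) t"
      by (intro continuous_intros) auto
  next
    have "isCont F 0"
      unfolding F_def using r c by (intro continuous_intros) auto
    then have "(F \<longlongrightarrow> F 0) (at_right 0)"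
      by (simp add: isCont_def filterlim_at_split)
    then show "((F \<circ> real_of_ereal) \<longlongrightarrow> F 0) (at_right (ereal 0))"
      by (simp only: ereal_tendsto_simps)
  next
    \<comment> \<open>The reciprocal root vanishes and the arctangent tends to pi/2.\<close>
    have "(F \<longlongrightarrow> 2 / c\<^sup>2 * (- (pi / 2) / c)) at_top"
      unfolding F_def using c by (real_asymp simp add: field_simps)
    then show "((F \<circ> real_of_ereal) \<longlongrightarrow> 2 / c\<^sup>2 * (- (pi / 2) / c)) (at_left \<infinity>)"
      by (simp only: ereal_tendsto_simps)
  qed auto
  also have "\<dots> = 2 / c\<^sup>2 * (1 / r - (pi / 2 - arctan (r / c)) / c)"
    using r c by (simp add: F_def field_simps)
  finally show ?thesis
    by (simp only: zero_ereal_def)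
qed

text \<open>On positive reals the principal complex root is the real one, and the two equal roots
  multiply to \<open>1 + t\<close>, which leaves a real integral.\<close>

lemma Carlson_RD_1_1:
  fixes z :: real
  assumes "z > 0"
  shows "Carlson_RD 1 1 (of_real z)
    = of_real (3 / 2 * (LBINT t=0..\<infinity>. 1 / ((1 + t) * (sqrt (z + t) * (z + t)))))"
proof -
  have "(LBINT t=0..\<infinity>. 1 / (csqrt (1 + of_real t) * csqrt (1 + of_real t)
          * csqrt (of_real z + of_real t) * (of_real z + of_real t)))
      = (LBINT t=0..\<infinity>. complex_of_real (1 / ((1 + t) * (sqrt (z + t) * (z + t)))))"
  proof (rule interval_integral_cong)
    fix t :: real assume "t \<in> einterval (min 0 \<infinity>) (max 0 \<infinity>)"
    then have "t > 0" by (auto simp: einterval_def)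
    then have "csqrt (of_real z + of_real t) = of_real (sqrt (z + t))"
      using assms csqrt_of_real[of "z + t"] by simp
    moreover have "csqrt (1 + of_real t) * csqrt (1 + of_real t) = 1 + of_real t"
      by (simp flip: power2_eq_square)
    ultimately show "1 / (csqrt (1 + of_real t) * csqrt (1 + of_real t)
          * csqrt (of_real z + of_real t) * (of_real z + of_real t))
        = complex_of_real (1 / ((1 + t) * (sqrt (z + t) * (z + t))))"
      by (simp add: mult.assoc)
  qed
  also have "\<dots> = of_real (LBINT t=0..\<infinity>. 1 / ((1 + t) * (sqrt (z + t) * (z + t))))"
    by (rule interval_lebesgue_integral_of_real)
  finally show ?thesis
    by (simp add: Carlson_RD_def)
qed

theorem lemma1:
  fixes x :: real
  assumes "x \<in> {0<..<1}"
  shows "1 / 3 * complex_of_real x * Carlson_RD 1 1 ((complex_of_real x)\<^sup>2)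
       = complex_of_real (1 / 2 * (deriv ^^ 2) (\<lambda>u::real. (arccos u)\<^sup>2) x)"
proof -
  define c where "c = sqrt (1 - x\<^sup>2)"
  have x: "0 < x" "x < 1" using assms by auto
  then have "1 - x\<^sup>2 > 0" by (simp add: abs_square_less_1)
  then have c: "c > 0" "c\<^sup>2 = 1 - x\<^sup>2" by (auto simp: c_def)
  \<comment> \<open>The complementary angle has sine \<open>x\<close> and cosine \<open>c\<close>,
    hence tangent \<open>x / c\<close>.\<close>
  have "arccos x = pi / 2 - arctan (x / c)"
    using x by (simp add: arccos_arctan c_def)
  moreover have "c\<^sup>2 + x\<^sup>2 = 1" using c by simp
  ultimately have "(LBINT t=0..\<infinity>. 1 / ((1 + t) * (sqrt (x\<^sup>2 + t) * (x\<^sup>2 + t))))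
      = 2 / c\<^sup>2 * (1 / x - arccos x / c)"
    using LBINT_inverse_three_halves[OF x(1) c(1)] by (simp only:)
  then have "Carlson_RD 1 1 ((complex_of_real x)\<^sup>2)
      = of_real (3 / 2 * (2 / c\<^sup>2 * (1 / x - arccos x / c)))"
    using Carlson_RD_1_1[of "x\<^sup>2"] x by (simp only: zero_less_power of_real_power)
  then have "1 / 3 * complex_of_real x * Carlson_RD 1 1 ((complex_of_real x)\<^sup>2)
      = of_real (1 / 3 * x * (3 / 2 * (2 / c\<^sup>2 * (1 / x - arccos x / c))))"
    by simp
  also have "1 / 3 * x * (3 / 2 * (2 / c\<^sup>2 * (1 / x - arccos x / c)))
      = 1 / 2 * (2 / c\<^sup>2 - 2 * x * arccos x / c\<^sup>2 / c)"
    using x c(1) by (simp add: field_simps)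
  also have "2 / c\<^sup>2 - 2 * x * arccos x / c\<^sup>2 / c = (deriv ^^ 2) (\<lambda>u. (arccos u)\<^sup>2) x"
    using second_deriv_arccos_squared[of x] x c by (simp add: c_def)
  finally show ?thesis .
qed

end
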